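(* Let $G$ be a compact group and let $f:G\to\mathbb{C}$ be a continuous function, not identically zero, satisfying the d'Alembert long equation $$f(xy)+f(yx)+f(xy^{-1})+f(y^{-1}x)=4f(x)f(y)\quad\text{for all } x,y\in G.$$ Then there is a representation $\varphi:G\to SU(2)$ such that $$f(x)=\frac{\chi_\varphi(x)}{2}\quad\text{for all } x\in G.$$
   Context: All representations are continuous: a representation $\varphi:G\to SU(2)$ is a continuous group homomorphism (not assumed irreducible) into the group $SU(2)$ of $2\times 2$ complex unitary matrices of determinant $1$. Its character is $\chi_\varphi(x)=\operatorname{tr}(\varphi(x))$. *)

theory Defs
  imports "HOL-Analysis.Analysis" "HOL-Algebra.Group"
begin

text \<open>The Hausdorff axiom is not part of the definition, so the notion covers both
  conventions for \<open>topological group\<close>.\<close>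

locale topological_group = group G for G :: "('a, 'm) monoid_scheme" (structure) +
  fixes T :: "'a topology"
  assumes topspace_eq_carrier: "topspace T = carrier G"
    and continuous_mult: "continuous_map (prod_topology T T) T (\<lambda>(x, y). x \<otimes> y)"
    and continuous_inv: "continuous_map T T (\<lambda>x. inv x)"

locale compact_group = topological_group +
  assumes compact: "compact_space T"

definition conj_transpose :: "complex^'n^'m \<Rightarrow> complex^'m^'n" where
  "conj_transpose A = (\<chi> i j. cnj (A $ j $ i))"

definition unitary_matrix :: "complex^'n^'n \<Rightarrow> bool" where
  "unitary_matrix A \<longleftrightarrow> A ** conj_transpose A = mat 1 \<and> conj_transpose A ** A = mat 1"

definition SU2 :: "(complex^2^2) monoid" where
  "SU2 = \<lparr>carrier = {A. unitary_matrix A \<and> det A = 1}, mult = (**), one = mat 1\<rparr>"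

definition SU2_representation ::
  "('a, 'm) monoid_scheme \<Rightarrow> 'a topology \<Rightarrow> ('a \<Rightarrow> complex^2^2) \<Rightarrow> bool" where
  "SU2_representation G T \<phi> \<longleftrightarrow>
     \<phi> \<in> hom G SU2 \<and> continuous_map T (top_of_set (carrier SU2)) \<phi>"

definition rep_character :: "('a \<Rightarrow> complex^2^2) \<Rightarrow> 'a \<Rightarrow> complex" where
  "rep_character \<phi> x = trace (\<phi> x)"

lemma conj_transpose_mult: "conj_transpose (A ** B) = conj_transpose B ** conj_transpose A"
  by (simp add: conj_transpose_def matrix_matrix_mult_def vec_eq_iff mult.commute)

lemma conj_transpose_conj_transpose: "conj_transpose (conj_transpose A) = A"
  by (simp add: conj_transpose_def vec_eq_iff)

lemma conj_transpose_mat_1: "conj_transpose (mat 1) = mat 1"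
  by (simp add: conj_transpose_def mat_def vec_eq_iff)

lemma det_conj_transpose: "det (conj_transpose (A :: complex^2^2)) = cnj (det A)"
  by (simp add: conj_transpose_def det_2)

lemma unitary_matrix_mult:
  assumes "unitary_matrix A" "unitary_matrix B"
  shows "unitary_matrix (A ** B)"
  using assms unfolding unitary_matrix_def conj_transpose_mult
  by (metis matrix_mul_assoc matrix_mul_rid)

lemma group_SU2: "group SU2"
proof (rule groupI)
  fix A assume A: "A \<in> carrier SU2"
  then have "conj_transpose A \<in> carrier SU2"
    by (simp add: SU2_def unitary_matrix_def conj_transpose_conj_transpose det_conj_transpose)
  moreover have "conj_transpose A \<otimes>\<^bsub>SU2\<^esub> A = \<one>\<^bsub>SU2\<^esub>"
    using A by (simp add: SU2_def unitary_matrix_def)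
  ultimately show "\<exists>B\<in>carrier SU2. B \<otimes>\<^bsub>SU2\<^esub> A = \<one>\<^bsub>SU2\<^esub>" by blast
qed (auto simp: SU2_def unitary_matrix_mult det_mul matrix_mul_assoc
  unitary_matrix_def[of "mat 1"] conj_transpose_mat_1)

end

(* Boundedness of n |-> f(x^n), a Chebyshev recurrence, makes f real with values in [-1, 1].
   Extend f linearly to the group algebra and put A = x + x^-1 - 2 f(x). The long equation says
   f(A z + z A) = 0; combining it for x and for x^2 gives f(A^2 z) = 0 for all z. So n |-> f(x^n z)
   satisfies a recurrence with a double characteristic factor, and as it is bounded the simple
   factor already annihilates it: f(A z) = 0, which is the short equation
   f(xz) + f(x^-1 z) = 2 f(x) f(z).

   The short equation determines f on the commutator [x, y] from f(x), f(y), f(xy). If f([x, y]) < 1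
   for some x, y, pick X, Y in SU(2) whose half traces match f at x, y, xy, and let phi(g) be the
   quaternion whose half traces against 1, X, Y, XY are f(g), f(gx), f(gy), f(gxy). The function
   K(z) = f(gz) - tr(phi(g) phi(z))/2 vanishes at 1, x, y, xy, hence K(zu) = K(u^-1 z) for u = x, y, xy;
   comparing the two ways to move xy across gives K(z) = K([x, y] z), and so K = 0.
   This makes phi multiplicative. If f is 1 on all commutators, f is the real part of a character. *)

theory Submission
  imports Defs
begin

section \<open>Bounded solutions of linear recurrences\<close>

text \<open>With \<open>S\<close> the shift, the hypotheses say that the square of
  \<open>S^2 - 2 * c * S + 1\<close> kills \<open>g\<close>. A nonzero \<open>u\<close> would be a
  resonance making \<open>g\<close> unbounded. The proof avoids roots: \<open>u\<close> is first
  shown to be square summable.\<close>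

lemma bounded_double_root_recurrence:
  fixes g :: "nat \<Rightarrow> real" and c B :: real
  assumes c: "\<bar>c\<bar> \<le> 1" and B: "\<And>n. \<bar>g n\<bar> \<le> B"
    and u: "\<And>n. u n = g (n + 2) + g n - 2 * c * g (n + 1)"
    and rec: "\<And>n. u (n + 2) + u n = 2 * c * u (n + 1)"
  shows "u 0 = 0"
proof -
  have B0: "B \<ge> 0" using B[of 0] by linarith
  have ub: "\<bar>u n\<bar> \<le> 4 * B" for n
  proof -
    have "\<bar>c * g (n + 1)\<bar> \<le> 1 * B"
      unfolding abs_mult by (intro mult_mono c B) auto
    then show ?thesis using u[of n] B[of n] B[of "n + 2"] by linarith
  qed
  \<comment> \<open>The discrete Wronskian of \<open>u\<close> and the shifted \<open>g\<close>.
    Since \<open>g\<close> solves the recurrence only up to the forcing term \<open>u\<close>, its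
    increments are the squares of \<open>u\<close>.\<close>
  define t where "t n = u n * g (n + 2) - u (n + 1) * g (n + 1)" for n
  have tb: "\<bar>t n\<bar> \<le> 8 * B * B" for n
  proof -
    have "\<bar>u n * g (n + 2)\<bar> \<le> 4 * B * B" "\<bar>u (n + 1) * g (n + 1)\<bar> \<le> 4 * B * B"
      unfolding abs_mult using B0 by (intro mult_mono ub B; simp)+
    then show ?thesis unfolding t_def by linarith
  qed
  have step: "(u (n + 1))\<^sup>2 = t (n + 1) - t n" for n
  proof -
    have "u (n + 2) = 2 * c * u (n + 1) - u n" using rec[of n] by linarith
    moreover have "g (n + 3) = u (n + 1) - g (n + 1) + 2 * c * g (n + 2)"
      using u[of "n + 1"] by (simp add: numeral_3_eq_3)
    moreover have "t (n + 1) = u (n + 1) * g (n + 3) - u (n + 2) * g (n + 2)"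
      unfolding t_def by (simp add: numeral_3_eq_3)
    ultimately show ?thesis
      unfolding t_def by (simp only: power2_eq_square) (simp add: algebra_simps)
  qed
  have sums: "(\<Sum>n<N. (u (n + 1))\<^sup>2) = t N - t 0" for N
    unfolding step by (induction N) auto
  have "(\<Sum>n<N. (u (n + 1))\<^sup>2) \<le> 16 * B * B" for N
    unfolding sums using tb[of N] tb[of 0] by linarith
  then have "summable (\<lambda>n. (u (n + 1))\<^sup>2)"
    by (intro summableI_nonneg_bounded) auto
  then have "(\<lambda>n. (u (n + 1))\<^sup>2) \<longlonglongrightarrow> 0" by (rule summable_LIMSEQ_zero)
  then have "(\<lambda>n. (u (Suc n))\<^sup>2) \<longlonglongrightarrow> 0" by simp
  then have lim2: "(\<lambda>n. (u n)\<^sup>2) \<longlonglongrightarrow> 0" by (rule LIMSEQ_imp_Suc)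
  then have lim: "u \<longlonglongrightarrow> 0" by simp
  \<comment> \<open>The quadratic form conserved by the recurrence for \<open>u\<close>. Its
    constant value is 0 because \<open>u\<close> tends to 0, and it is positive semidefinite because
    \<open>c\<close> has modulus at most 1.\<close>
  define q where "q n = (u (n + 1))\<^sup>2 + (u n)\<^sup>2 - 2 * c * u n * u (n + 1)" for n
  have "q (Suc n) = q n" for n
  proof -
    have "q (Suc n) = (u (n + 2))\<^sup>2 + (u (n + 1))\<^sup>2 - 2 * c * u (n + 1) * u (n + 2)"
      unfolding q_def by simp
    then show ?thesis unfolding q_def using rec[of n] by algebra
  qed
  then have qc: "q n = q 0" for n by (induction n) auto
  have "(\<lambda>n. u (Suc n)) \<longlonglongrightarrow> 0" using lim by (rule LIMSEQ_Suc)
  then have "q \<longlonglongrightarrow> 0\<^sup>2 + 0\<^sup>2 - 2 * c * 0 * 0"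
    unfolding q_def Suc_eq_plus1[symmetric] by (intro tendsto_intros lim)
  moreover have "q \<longlonglongrightarrow> q 0"
    by (rule tendsto_eventually, rule always_eventually) (blast intro: qc)
  ultimately have "q 0 = 0" using LIMSEQ_unique by fastforce
  then have "q n = 0" for n using qc by simp
  then have sq: "(u (n + 1) - c * u n)\<^sup>2 + (1 - c\<^sup>2) * (u n)\<^sup>2 = 0" for n
    unfolding q_def by (simp add: power2_eq_square algebra_simps)
  have c2: "1 - c\<^sup>2 \<ge> 0" using c by (simp add: abs_square_le_1)
  have "(u (n + 1) - c * u n)\<^sup>2 = 0" and d: "(1 - c\<^sup>2) * (u n)\<^sup>2 = 0" for n
    using sq[of n] mult_nonneg_nonneg[OF c2 zero_le_power2[of "u n"]]
      zero_le_power2[of "u (n + 1) - c * u n"] by linarith+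
  then have geom: "u (Suc n) = c * u n" for n by simp
  show ?thesis
  \<comment> \<open>For \<open>c = 1\<close> or \<open>c = -1\<close> the form is degenerate; then
    the modulus of \<open>u\<close> is constant and the limit is used once more.\<close>
  proof (cases "c\<^sup>2 = 1")
    case True
    then have "(u (Suc n))\<^sup>2 = (u n)\<^sup>2" for n
      by (simp add: geom power_mult_distrib)
    then have "(u n)\<^sup>2 = (u 0)\<^sup>2" for n by (induction n) auto
    then have "(\<lambda>n. (u n)\<^sup>2) \<longlonglongrightarrow> (u 0)\<^sup>2"
      by (intro tendsto_eventually always_eventually) blast
    then show ?thesis using lim2 LIMSEQ_unique by fastforce
  next
    case False
    then show ?thesis using d[of 0] by simp
  qed
qed

text \<open>The solution is \<open>h n = (w^n + w^(-n)) / 2\<close> with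
  \<open>w + 1/w = 2 * h 1\<close>. Boundedness puts \<open>w\<close> and its inverse in the closed
  unit disc, so \<open>w\<close> is on the unit circle and \<open>h 1 = Re w\<close>.\<close>

lemma bounded_chebyshev_recurrence:
  fixes h :: "nat \<Rightarrow> complex"
  assumes h0: "h 0 = 1" and rec: "\<And>n. h (n + 2) + h n = 2 * h 1 * h (n + 1)"
    and B: "\<And>n. cmod (h n) \<le> B"
  shows "h 1 \<in> \<real>" "cmod (h 1) \<le> 1"
proof -
  define w where "w = h 1 + csqrt ((h 1)\<^sup>2 - 1)"
  have "(w - h 1)\<^sup>2 = (h 1)\<^sup>2 - 1" unfolding w_def by simp
  then have w1: "w * (2 * h 1 - w) = 1" by (simp add: power2_eq_square algebra_simps)
  then have w0: "w \<noteq> 0" by auto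
  have winv: "inverse w = 2 * h 1 - w" using w1 by (simp add: inverse_unique)
  \<comment> \<open>Stated for either ordering of the two roots, to be used for \<open>w\<close> and
    for \<open>inverse w\<close>.\<close>
  have le1: "cmod v \<le> 1" if v: "v * v' = 1" "v + v' = 2 * h 1" for v v'
  proof (rule ccontr)
    assume "\<not> cmod v \<le> 1"
    then have v1: "cmod v > 1" by simp
    have hn: "2 * h n = v ^ n + v' ^ n" for n
    proof (induction n rule: nat_less_induct)
      case (1 n)
      consider "n = 0" | "n = 1" | m where "n = m + 2"
        by (metis One_nat_def add_2_eq_Suc' not0_implies_Suc)
      then show ?case
      proof cases
        case 3
        have a: "2 * h (m + 1) = v ^ (m + 1) + v' ^ (m + 1)" "2 * h m = v ^ m + v' ^ m"
          using 1 3 by auto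
        have "h (m + 2) = 2 * h 1 * h (m + 1) - h m"
          using rec[of m] by (simp only: eq_diff_eq)
        then have "2 * h (m + 2) = (2 * h 1) * (2 * h (m + 1)) - 2 * h m"
          by (simp only: right_diff_distrib) simp
        also have "\<dots> = (v + v') * (v ^ (m + 1) + v' ^ (m + 1)) - (v * v') * (v ^ m + v' ^ m)"
          unfolding a v by simp
        also have "\<dots> = v ^ (m + 2) + v' ^ (m + 2)" by (simp add: algebra_simps)
        finally show ?thesis using 3 by simp
      qed (use h0 v in auto)
    qed
    have vv: "cmod v * cmod v' = 1" using v(1) by (metis norm_mult norm_one)
    have v'1: "cmod v' \<le> 1"
    proof (rule ccontr)
      assume "\<not> cmod v' \<le> 1"
      then have "cmod v * cmod v' > 1 * 1" using v1 by (intro mult_strict_mono) auto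
      then show False using vv by simp
    qed
    have "cmod v ^ n \<le> 2 * B + 1" for n
    proof -
      have "cmod (v ^ n) \<le> cmod (2 * h n) + cmod (v' ^ n)"
        unfolding hn by (metis add_diff_cancel_right' norm_triangle_ineq4)
      also have "cmod (v' ^ n) \<le> 1" using v'1 by (simp add: norm_power power_le_one)
      finally show ?thesis using B[of n] by (simp add: norm_power norm_mult)
    qed
    then show False using real_arch_pow[OF v1] by (meson not_le)
  qed
  have a: "cmod w \<le> 1" by (rule le1[of w "2 * h 1 - w"]) (use w1 in auto)
  have b: "cmod (inverse w) \<le> 1"
  proof (rule le1)
    show "inverse w * w = 1" using w0 by simp
    show "inverse w + w = 2 * h 1" unfolding winv by simp
  qed
  have "cmod w = 1" using a b w0 by (simp add: norm_inverse inverse_le_1_iff)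
  then have "inverse w = cnj w"
    by (simp add: inverse_unique complex_norm_square[symmetric])
  then have "2 * h 1 = w + cnj w" using winv by (metis add.commute diff_add_cancel)
  also have "\<dots> = 2 * of_real (Re w)" unfolding complex_add_cnj by simp
  finally have eq: "h 1 = of_real (Re w)" by simp
  show "h 1 \<in> \<real>" unfolding eq by simp
  show "cmod (h 1) \<le> 1" unfolding eq using a abs_Re_le_cmod[of w] by (simp add: )
qed

section \<open>Trace identities from the short equation\<close>

lemma (in group) inv_cancel: "x \<in> carrier G \<Longrightarrow> y \<in> carrier G \<Longrightarrow> inv x \<otimes> (x \<otimes> y) = y"
  "x \<in> carrier G \<Longrightarrow> y \<in> carrier G \<Longrightarrow> x \<otimes> (inv x \<otimes> y) = y"
  by (simp_all add: m_assoc[symmetric])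

locale dalembert_function = group G for G (structure) +
  fixes f :: "'a \<Rightarrow> real"
  assumes f_one: "f \<one> = 1"
    and f_le_one: "x \<in> carrier G \<Longrightarrow> \<bar>f x\<bar> \<le> 1"
    and dalembert: "x \<in> carrier G \<Longrightarrow> y \<in> carrier G \<Longrightarrow>
      f (x \<otimes> y) + f (inv x \<otimes> y) = 2 * f x * f y"
begin

lemma f_inv: "x \<in> carrier G \<Longrightarrow> f (inv x) = f x"
  using dalembert[of x \<one>] f_one by simp

lemma f_comm:
  assumes "x \<in> carrier G" "y \<in> carrier G"
  shows "f (x \<otimes> y) = f (y \<otimes> x)"
proof -
  have "f (inv y \<otimes> x) = f (inv x \<otimes> y)"
    using f_inv[of "inv y \<otimes> x"] assms by (simp add: inv_mult_group)
  then show ?thesis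
    using dalembert[of x y] dalembert[of y x] assms by (simp add: algebra_simps)
qed

text \<open>Cyclic invariance rotates \<open>u\<close> to the front, so the equation holds at every
  position of a product.\<close>

lemma dalembert_mid:
  assumes [simp]: "z \<in> carrier G" "u \<in> carrier G" "w \<in> carrier G"
  shows "f (z \<otimes> (u \<otimes> w)) + f (z \<otimes> (inv u \<otimes> w)) = 2 * f u * f (z \<otimes> w)"
proof -
  have "f (z \<otimes> (v \<otimes> w)) = f (v \<otimes> (w \<otimes> z))" if "v \<in> carrier G" for v
    using f_comm[of z "v \<otimes> w"] that by (simp add: m_assoc)
  then show ?thesis using dalembert[of u "w \<otimes> z"] f_comm[of z w] by simp
qed

lemma dalembert_right:
  assumes "x \<in> carrier G" "y \<in> carrier G"
  shows "f (x \<otimes> y) + f (x \<otimes> inv y) = 2 * f x * f y"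
  using dalembert_mid[of x y \<one>] assms by simp

lemma f_square_mid:
  assumes [simp]: "z \<in> carrier G" "u \<in> carrier G" "w \<in> carrier G"
  shows "f (z \<otimes> (u \<otimes> (u \<otimes> w))) = 2 * f u * f (z \<otimes> (u \<otimes> w)) - f (z \<otimes> w)"
  using dalembert_mid[of z u "u \<otimes> w"] by (simp add: inv_cancel)

lemma f_square_right:
  assumes [simp]: "z \<in> carrier G" "u \<in> carrier G"
  shows "f (z \<otimes> (u \<otimes> u)) = 2 * f u * f (z \<otimes> u) - f z"
  using f_square_mid[of z u \<one>] by simp

text \<open>Fricke's identity for the trace of a commutator in SL(2), written for half
  traces.\<close>

lemma f_commutator:
  assumes [simp]: "x \<in> carrier G" "y \<in> carrier G"
  shows "f (inv x \<otimes> (inv y \<otimes> (x \<otimes> y))) =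
    2 * ((f x)\<^sup>2 + (f y)\<^sup>2 + (f (x \<otimes> y))\<^sup>2 - 2 * f x * f y * f (x \<otimes> y)) - 1"
proof -
  have "f (inv y \<otimes> (x \<otimes> y)) = f x"
    using f_comm[of "inv y" "x \<otimes> y"] by (simp add: m_assoc)
  then have 1: "f (x \<otimes> (inv y \<otimes> (x \<otimes> y))) + f (inv x \<otimes> (inv y \<otimes> (x \<otimes> y))) = 2 * f x * f x"
    using dalembert[of x "inv y \<otimes> (x \<otimes> y)"] by simp
  have "f (y \<otimes> (inv x \<otimes> (x \<otimes> y))) = 2 * f y * f y - 1"
    using f_square_mid[of \<one> y \<one>] f_one by (simp add: inv_cancel)
  \<comment> \<open>The short equation for the pair \<open>x inv y\<close>, \<open>x y\<close>:
    inverting the first factor turns the product into \<open>y y\<close>.\<close>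
  then have 2: "f (x \<otimes> (inv y \<otimes> (x \<otimes> y))) + (2 * f y * f y - 1)
      = 2 * f (x \<otimes> inv y) * f (x \<otimes> y)"
    using dalembert[of "x \<otimes> inv y" "x \<otimes> y"] by (simp add: m_assoc inv_mult_group)
  have 3: "f (x \<otimes> inv y) = 2 * f x * f y - f (x \<otimes> y)"
    using dalembert_right[of x y] by simp
  show ?thesis using 1 2 unfolding 3 by (simp add: power2_eq_square algebra_simps)
qed

lemma f_commutator_le: "x \<in> carrier G \<Longrightarrow> y \<in> carrier G \<Longrightarrow>
    f (inv x \<otimes> (inv y \<otimes> (x \<otimes> y))) \<le> 1"
  using f_le_one[of "inv x \<otimes> (inv y \<otimes> (x \<otimes> y))"] by simp

text \<open>The difference of the two sides is the Gram determinant of \<open>1\<close>,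
  \<open>inv x\<close>, \<open>y\<close> for the half-trace form. By Fricke's identity it is half of
  1 minus the value of \<open>f\<close> at the commutator.\<close>

lemma f_gram_nonneg:
  assumes "x \<in> carrier G" "y \<in> carrier G"
  shows "(f (x \<otimes> y) - f x * f y)\<^sup>2 \<le> (1 - (f x)\<^sup>2) * (1 - (f y)\<^sup>2)"
  using f_commutator[OF assms] f_commutator_le[OF assms]
  by (simp add: power2_eq_square algebra_simps)

lemma f_mult_square_one:
  assumes "x \<in> carrier G" "y \<in> carrier G" "(f x)\<^sup>2 = 1"
  shows "f (x \<otimes> y) = f x * f y"
  using f_gram_nonneg[of x y] assms by simp

section \<open>Translates of \<open>f\<close> and a vanishing criterion\<close>

text \<open>The linear span of the translates of \<open>f\<close> consists of such functions.\<close>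

definition dalembert_linear :: "('a \<Rightarrow> real) \<Rightarrow> bool" where
  "dalembert_linear K \<longleftrightarrow> (\<forall>z\<in>carrier G. \<forall>u\<in>carrier G. \<forall>w\<in>carrier G.
     K (z \<otimes> (u \<otimes> w)) + K (z \<otimes> (inv u \<otimes> w)) = 2 * f u * K (z \<otimes> w))"

lemma dalembert_linearD:
  assumes "dalembert_linear K" "z \<in> carrier G" "u \<in> carrier G" "w \<in> carrier G"
  shows "K (z \<otimes> (u \<otimes> w)) + K (z \<otimes> (inv u \<otimes> w)) = 2 * f u * K (z \<otimes> w)"
  using assms unfolding dalembert_linear_def by blast

text \<open>\<open>K \<one> = 0\<close> makes \<open>K\<close> odd under inversion, and
  \<open>K u = 0\<close> makes \<open>K (inv u \<otimes> z)\<close> odd under inverting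
  \<open>z\<close>; the two signs cancel.\<close>

lemma dalembert_linear_flip:
  assumes K: "dalembert_linear K" and K1: "K \<one> = 0" and Ku: "K u = 0"
    and [simp]: "u \<in> carrier G" "z \<in> carrier G"
  shows "K (z \<otimes> u) = K (inv u \<otimes> z)"
proof -
  have "K (z \<otimes> u) = - K (inv u \<otimes> inv z)"
    using dalembert_linearD[OF K, of \<one> "z \<otimes> u" \<one>] K1 by (simp add: inv_mult_group)
  moreover have "K (inv u) = 0"
    using dalembert_linearD[OF K, of \<one> u \<one>] K1 Ku by simp
  then have "K (inv u \<otimes> z) + K (inv u \<otimes> inv z) = 0"
    using dalembert_linearD[OF K, of "inv u" z \<one>] by simp
  ultimately show ?thesis by simp
qed

text \<open>Once \<open>K\<close> is invariant under left translation by \<open>?c\<close> and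
  \<open>inv ?c\<close>, the defining relation of \<open>K\<close> becomes
  \<open>2 * K z = 2 * f ?c * K z\<close>.\<close>

lemma dalembert_linear_eq_0:
  assumes K: "dalembert_linear K" and K1: "K \<one> = 0"
    and Kx: "K x = 0" and Ky: "K y = 0" and Kxy: "K (x \<otimes> y) = 0"
    and c: "f (inv x \<otimes> (inv y \<otimes> (x \<otimes> y))) \<noteq> 1"
    and [simp]: "x \<in> carrier G" "y \<in> carrier G" "z \<in> carrier G"
  shows "K z = 0"
proof -
  let ?c = "inv x \<otimes> (inv y \<otimes> (x \<otimes> y))"
  have swap: "K (inv y \<otimes> (inv x \<otimes> z)) = K (inv x \<otimes> (inv y \<otimes> z))"
    if [simp]: "z \<in> carrier G" for z
  proof -
    have "K (inv y \<otimes> (inv x \<otimes> z)) = K (z \<otimes> (x \<otimes> y))"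
      using dalembert_linear_flip[OF K K1 Kxy, of z] by (simp add: inv_mult_group m_assoc)
    also have "\<dots> = K (inv y \<otimes> (z \<otimes> x))"
      using dalembert_linear_flip[OF K K1 Ky, of "z \<otimes> x"] by (simp add: m_assoc)
    also have "\<dots> = K (inv x \<otimes> (inv y \<otimes> z))"
      using dalembert_linear_flip[OF K K1 Kx, of "inv y \<otimes> z"] by (simp add: m_assoc)
    finally show ?thesis .
  qed
  have cz: "K (?c \<otimes> z) = K z" if [simp]: "z \<in> carrier G" for z
    using swap[of "x \<otimes> (y \<otimes> z)"] by (simp add: m_assoc inv_cancel)
  have "K (inv ?c \<otimes> z) = K z"
    using cz[of "inv ?c \<otimes> z"] by (simp add: inv_cancel)
  then have "2 * K z = 2 * f ?c * K z"
    using dalembert_linearD[OF K, of \<one> ?c z] cz[of z] by simp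
  then show ?thesis using c by simp
qed

section \<open>Trivial commutators: cosine and sine of a character\<close>

lemma f_abelian:
  assumes c: "\<And>x y. x \<in> carrier G \<Longrightarrow> y \<in> carrier G \<Longrightarrow>
      f (inv x \<otimes> (inv y \<otimes> (x \<otimes> y))) = 1"
    and [simp]: "x \<in> carrier G" "y \<in> carrier G" "z \<in> carrier G"
  shows "f (x \<otimes> (y \<otimes> z)) = f (y \<otimes> (x \<otimes> z))"
proof -
  let ?c = "inv x \<otimes> (inv y \<otimes> (x \<otimes> y))"
  have "f (?c \<otimes> (z \<otimes> (y \<otimes> x))) = f (z \<otimes> (y \<otimes> x))"
    using f_mult_square_one[of ?c "z \<otimes> (y \<otimes> x)"] c[of x y] by simp
  moreover have "f (?c \<otimes> (z \<otimes> (y \<otimes> x))) = f (x \<otimes> (y \<otimes> z))"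
    using f_comm[of "inv x \<otimes> inv y" "x \<otimes> (y \<otimes> (z \<otimes> (y \<otimes> x)))"]
    by (simp add: m_assoc inv_cancel)
  moreover have "f (z \<otimes> (y \<otimes> x)) = f (y \<otimes> (x \<otimes> z))"
    using f_comm[of z "y \<otimes> x"] by (simp add: m_assoc)
  ultimately show ?thesis by simp
qed

text \<open>The cosine addition formula for \<open>f (g \<otimes> x)\<close>, solved for the sine at
  \<open>g\<close>. The square root fixes the sign so that the sine at \<open>x\<close> is
  positive.\<close>

definition sine :: "'a \<Rightarrow> 'a \<Rightarrow> real" where
  "sine x g = (f x * f g - f (g \<otimes> x)) / sqrt (1 - (f x)\<^sup>2)"

text \<open>The defect \<open>K\<close> of the cosine formula vanishes at \<open>\<one>\<close> and
  \<open>x\<close> and does not see on which side \<open>inv x\<close> multiplies. Flipping then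
  gives \<open>K (h \<otimes> x) = f x * K h\<close> and
  \<open>K h = f x * K (h \<otimes> x)\<close>, so \<open>fx\<close> forces \<open>K h = 0\<close>.
  The sine formula follows from the cosine formula at \<open>h\<close> and at
  \<open>h \<otimes> x\<close>.\<close>

lemma abelian_character:
  assumes c: "\<And>x y. x \<in> carrier G \<Longrightarrow> y \<in> carrier G \<Longrightarrow>
      f (inv x \<otimes> (inv y \<otimes> (x \<otimes> y))) = 1"
    and x[simp]: "x \<in> carrier G" and fx: "(f x)\<^sup>2 \<noteq> 1"
    and g[simp]: "g \<in> carrier G" and h[simp]: "h \<in> carrier G"
  shows "f (g \<otimes> h) = f g * f h - sine x g * sine x h"
    and "sine x (g \<otimes> h) = f g * sine x h + sine x g * f h"
proof -
  define s where "s = sqrt (1 - (f x)\<^sup>2)"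
  have p2: "(f x)\<^sup>2 < 1" using f_le_one[OF x] fx by (simp add: abs_square_le_1 order_less_le)
  have s: "s > 0" "s * s = 1 - f x * f x"
    using p2 unfolding s_def by (simp_all add: power2_eq_square)
  have s1: "s * sine x g = f x * f g - f (g \<otimes> x)" for g
    using s(1) unfolding sine_def s_def by simp
  have ssx: "s * (s * sine x (h \<otimes> x)) = s * (s * (s * f h + f x * sine x h))"
    if "h \<in> carrier G" for h
  proof -
    have "s * sine x (h \<otimes> x) = f h - f x * f (h \<otimes> x)"
      using s1[of "h \<otimes> x"] f_square_right[of h x] that by (simp add: m_assoc)
    also have "\<dots> = (1 - f x * f x) * f h + f x * (s * sine x h)"
      unfolding s1 by (simp add: algebra_simps)
    also have "\<dots> = s * (s * f h + f x * sine x h)"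
      unfolding s(2)[symmetric] by (simp add: algebra_simps)
    finally show ?thesis by simp
  qed
  have sx: "sine x (h \<otimes> x) = s * f h + f x * sine x h" if "h \<in> carrier G" for h
    using ssx[OF that] s(1) by simp
  have add: "f (g \<otimes> h) = f g * f h - sine x g * sine x h"
    if g[simp]: "g \<in> carrier G" and h[simp]: "h \<in> carrier G" for g h
  proof -
    define K where "K z = f (g \<otimes> z) - (f g * f z - sine x g * sine x z)" for z
    have lin: "dalembert_linear K"
      unfolding dalembert_linear_def
    proof (intro ballI)
      fix z u w assume [simp]: "z \<in> carrier G" "u \<in> carrier G" "w \<in> carrier G"
      have 1: "f (g \<otimes> (z \<otimes> (u \<otimes> w))) + f (g \<otimes> (z \<otimes> (inv u \<otimes> w)))
          = 2 * f u * f (g \<otimes> (z \<otimes> w))"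
        using dalembert_mid[of "g \<otimes> z" u w] by (simp add: m_assoc)
      have 2: "f (z \<otimes> (u \<otimes> w)) + f (z \<otimes> (inv u \<otimes> w)) = 2 * f u * f (z \<otimes> w)"
        by (rule dalembert_mid) simp_all
      have 3: "f (z \<otimes> (u \<otimes> (w \<otimes> x))) + f (z \<otimes> (inv u \<otimes> (w \<otimes> x)))
          = 2 * f u * f (z \<otimes> (w \<otimes> x))"
        by (rule dalembert_mid) simp_all
      have "s * sine x (z \<otimes> (u \<otimes> w)) + s * sine x (z \<otimes> (inv u \<otimes> w))
          = s * (2 * f u * sine x (z \<otimes> w))"
      proof -
        have "s * sine x (z \<otimes> (u \<otimes> w)) + s * sine x (z \<otimes> (inv u \<otimes> w))
          = f x * (f (z \<otimes> (u \<otimes> w)) + f (z \<otimes> (inv u \<otimes> w)))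
            - (f (z \<otimes> (u \<otimes> (w \<otimes> x))) + f (z \<otimes> (inv u \<otimes> (w \<otimes> x))))"
          unfolding s1 by (simp add: m_assoc algebra_simps)
        also have "\<dots> = 2 * f u * (s * sine x (z \<otimes> w))"
          unfolding s1 2 3 by (simp add: m_assoc algebra_simps)
        finally show ?thesis by simp
      qed
      then have 4: "sine x (z \<otimes> (u \<otimes> w)) + sine x (z \<otimes> (inv u \<otimes> w))
          = 2 * f u * sine x (z \<otimes> w)"
        using s(1) by (simp add: distrib_left[symmetric])
      have "K (z \<otimes> (u \<otimes> w)) + K (z \<otimes> (inv u \<otimes> w)) =
          (f (g \<otimes> (z \<otimes> (u \<otimes> w))) + f (g \<otimes> (z \<otimes> (inv u \<otimes> w))))
          - f g * (f (z \<otimes> (u \<otimes> w)) + f (z \<otimes> (inv u \<otimes> w)))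
          + sine x g * (sine x (z \<otimes> (u \<otimes> w)) + sine x (z \<otimes> (inv u \<otimes> w)))"
        unfolding K_def by (simp add: algebra_simps)
      then show "K (z \<otimes> (u \<otimes> w)) + K (z \<otimes> (inv u \<otimes> w)) = 2 * f u * K (z \<otimes> w)"
        unfolding 1 2 4 unfolding K_def by (simp add: algebra_simps)
    qed
    have sine1: "sine x \<one> = 0" unfolding sine_def by (simp add: f_one)
    have K1: "K \<one> = 0" unfolding K_def by (simp add: f_one sine1)
    have "sine x x = s" using sx[of \<one>] by (simp add: f_one sine1)
    then have Kx: "K x = 0" unfolding K_def using s1[of g] by (simp add: mult.commute)
    have Kc: "K (inv x \<otimes> z) = K (z \<otimes> inv x)" if [simp]: "z \<in> carrier G" for z
    proof -
      have 1: "f (inv x \<otimes> z) = f (z \<otimes> inv x)" by (rule f_comm) simp_all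
      have 2: "f (g \<otimes> (inv x \<otimes> z)) = f (g \<otimes> (z \<otimes> inv x))"
        using f_abelian[OF c, of g "inv x" z] f_comm[of "inv x" "g \<otimes> z"] by (simp add: m_assoc)
      have 3: "f (inv x \<otimes> (z \<otimes> x)) = f (z \<otimes> (inv x \<otimes> x))"
        using f_abelian[OF c, of "inv x" z x] by simp
      show ?thesis unfolding K_def sine_def using 1 2 3 by (simp add: m_assoc)
    qed
    have "K (h \<otimes> x) = K (h \<otimes> inv x)"
      using dalembert_linear_flip[OF lin K1 Kx x h] Kc by simp
    moreover have "K (h \<otimes> (x \<otimes> x)) = K h"
      using dalembert_linear_flip[OF lin K1 Kx x, of "h \<otimes> x"] Kc[of "h \<otimes> x"]
      by (simp add: m_assoc)
    moreover have "K (h \<otimes> x) + K (h \<otimes> inv x) = 2 * f x * K h"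
      using dalembert_linearD[OF lin, of h x \<one>] by simp
    moreover have "K (h \<otimes> (x \<otimes> x)) + K h = 2 * f x * K (h \<otimes> x)"
      using dalembert_linearD[OF lin, of h x x] by simp
    ultimately have "K h = f x * (f x * K h)" by simp
    then have "(1 - (f x)\<^sup>2) * K h = 0" by (simp add: power2_eq_square algebra_simps)
    then show ?thesis using fx unfolding K_def by simp
  qed
  show "f (g \<otimes> h) = f g * f h - sine x g * sine x h" by (rule add) simp_all
  have "s * sine x (g \<otimes> h) = f x * (f g * f h - sine x g * sine x h)
      - (f g * f (h \<otimes> x) - sine x g * (s * f h + f x * sine x h))"
    unfolding s1 using add[of g h] add[of g "h \<otimes> x"] sx[of h] by (simp add: m_assoc)
  also have "f (h \<otimes> x) = f x * f h - s * sine x h" unfolding s1 by simp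
  finally have "s * sine x (g \<otimes> h) = s * (f g * sine x h + sine x g * f h)"
    by (simp add: algebra_simps)
  then show "sine x (g \<otimes> h) = f g * sine x h + sine x g * f h" using s(1) by simp
qed

end

section \<open>A nontrivial commutator: reconstruction of quaternions\<close>

text \<open>The matrices \<open>X\<close> = ((P, 0), (0, cnj P)) and \<open>Y\<close> = ((Q, t), (-t, cnj Q)) in SU(2) are the
  images of two elements \<open>x\<close>, \<open>y\<close> with \<open>f [x, y] < 1\<close>. The image ((a, b), (-cnj b, cnj a)) of \<open>g\<close>
  is recovered from its half traces against 1, \<open>X\<close>, \<open>Y\<close> and \<open>X Y\<close>, which have to be
  \<open>f g\<close>, \<open>f (g x)\<close>, \<open>f (g y)\<close> and \<open>f (g x y)\<close>.\<close>

locale dalembert_frame = dalembert_function +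
  fixes x y :: 'a
  assumes x[simp]: "x \<in> carrier G" and y[simp]: "y \<in> carrier G"
    and commutator: "f (inv x \<otimes> (inv y \<otimes> (x \<otimes> y))) < 1"
begin

text \<open>\<open>P\<close> and the row \<open>(Q, t)\<close> must have norm 1 and real parts
  \<open>f x\<close>, \<open>f y\<close>, and the half trace \<open>f x * f y - s * e\<close> of
  \<open>X Y\<close> must be \<open>f (x \<otimes> y)\<close>. With \<open>s\<close> and
  \<open>t\<close> positive this determines all three numbers.\<close>

definition s :: real where "s = sqrt (1 - (f x)\<^sup>2)"
definition e :: real where "e = (f x * f y - f (x \<otimes> y)) / s"
definition t :: real where "t = sqrt (1 - (f y)\<^sup>2 - e\<^sup>2)"

text \<open>The hypothesis \<open>commutator\<close> makes the Gram inequality strict. This excludes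
  \<open>(f x)^2 = 1\<close>, and after division by \<open>s * s\<close> it is the positivity of
  \<open>t * t\<close>.\<close>

lemma s_pos: "s > 0" and s_square: "s * s = 1 - f x * f x" and s_e: "s * e = f x * f y - f (x \<otimes> y)"
  and t_pos: "t > 0" and t_square: "t * t = 1 - f y * f y - e * e"
proof -
  have gram: "(f (x \<otimes> y) - f x * f y)\<^sup>2 < (1 - (f x)\<^sup>2) * (1 - (f y)\<^sup>2)"
    using f_commutator[OF x y] commutator by (simp add: power2_eq_square algebra_simps)
  have "(f x)\<^sup>2 \<noteq> 1"
  proof
    assume "(f x)\<^sup>2 = 1"
    then have "(f (x \<otimes> y) - f x * f y)\<^sup>2 < 0" using gram by simp
    then show False by (simp add: not_less[symmetric])
  qed
  then have p2: "(f x)\<^sup>2 < 1" using f_le_one[OF x] by (simp add: abs_square_le_1 order_less_le)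
  then show s: "s > 0" and s2: "s * s = 1 - f x * f x"
    unfolding s_def by (simp_all add: power2_eq_square)
  then show se: "s * e = f x * f y - f (x \<otimes> y)" unfolding e_def by simp
  have "(s * s) * (1 - f y * f y - e * e) = (1 - f x * f x) * (1 - f y * f y) - (s * e) * (s * e)"
    unfolding s2[symmetric] by (simp add: algebra_simps)
  also have "\<dots> > 0" unfolding se using gram by (simp add: power2_eq_square algebra_simps)
  finally have "1 - f y * f y - e * e > 0" using s by (simp add: zero_less_mult_iff)
  then show "t > 0" and "t * t = 1 - f y * f y - e * e"
    unfolding t_def by (simp_all add: power2_eq_square)
qed

text \<open>With \<open>f g\<close> as first coordinate, the linear system for the half traces is
  triangular and is solved in turn from the products of \<open>g\<close> with \<open>x\<close>,
  \<open>y\<close> and \<open>x \<otimes> y\<close>. The solutions are linear combinations of right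
  translates of \<open>f\<close>, hence inherit its continuity.\<close>

definition m1 where "m1 g = (f x * f g - f (g \<otimes> x)) / s"
definition m2 where "m2 g = (f y * f g - e * m1 g - f (g \<otimes> y)) / t"
definition m3 where "m3 g =
  ((f g * (f x * f y - s * e) - m1 g * (f x * e + s * f y) - f (g \<otimes> (x \<otimes> y))) / t - f x * m2 g) / s"

definition a where "a g = Complex (f g) (m1 g)"
definition b where "b g = Complex (m2 g) (m3 g)"
definition P where "P = Complex (f x) s"
definition Q where "Q = Complex (f y) e"

text \<open>A relation with free values, so that each identity for \<open>a\<close> and
  \<open>b\<close> reduces to comparing four half traces.\<close>

definition half_traces :: "complex \<Rightarrow> complex \<Rightarrow> real \<Rightarrow> real \<Rightarrow> real \<Rightarrow> real \<Rightarrow> bool" where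
  "half_traces u v c1 cx cy cxy \<longleftrightarrow> Re u = c1 \<and> Re (u * P) = cx \<and> Re (u * Q) - t * Re v = cy \<and>
     Re (u * P * Q) - t * Re (v * cnj P) = cxy"

text \<open>The elements 1, \<open>X\<close>, \<open>Y\<close>, \<open>X Y\<close> form a real basis
  of the quaternions because \<open>s\<close> and \<open>t\<close> are nonzero.\<close>

lemma half_traces_unique:
  assumes "half_traces u v c1 cx cy cxy" "half_traces u' v' c1 cx cy cxy"
  shows "u = u'" "v = v'"
proof -
  have 1: "Re u = Re u'" and "Re (u * P) = Re (u' * P)"
    using assms unfolding half_traces_def by metis+
  then have 2: "Im u = Im u'" using s_pos by (simp add: P_def)
  show u: "u = u'" using 1 2 by (simp add: complex_eq_iff)
  have "t * Re v = t * Re v'" "t * Re (v * cnj P) = t * Re (v' * cnj P)"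
    using assms unfolding half_traces_def u by linarith+
  then show "v = v'" using t_pos s_pos by (simp add: P_def complex_eq_iff)
qed

lemma half_traces_ab: "half_traces (a g) (b g) (f g) (f (g \<otimes> x)) (f (g \<otimes> y)) (f (g \<otimes> (x \<otimes> y)))"
proof -
  have 1: "s * m1 g = f x * f g - f (g \<otimes> x)" using s_pos unfolding m1_def by simp
  have 2: "t * m2 g = f y * f g - e * m1 g - f (g \<otimes> y)" using t_pos unfolding m2_def by simp
  have "s * m3 g = (f g * (f x * f y - s * e) - m1 g * (f x * e + s * f y)
      - f (g \<otimes> (x \<otimes> y))) / t - f x * m2 g"
    using s_pos unfolding m3_def by simp
  then have 3: "t * (f x * m2 g + s * m3 g) = f g * (f x * f y - s * e)
      - m1 g * (f x * e + s * f y) - f (g \<otimes> (x \<otimes> y))"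
    using t_pos by simp
  show ?thesis
    unfolding half_traces_def a_def b_def P_def Q_def
    using 1 2 3 by (simp add: algebra_simps)
qed

lemma half_tracesI:
  assumes "half_traces u v (f g) (f (g \<otimes> x)) (f (g \<otimes> y)) (f (g \<otimes> (x \<otimes> y)))"
  shows "a g = u" "b g = v"
  using half_traces_unique[OF half_traces_ab assms] by simp_all

lemma half_traces_eqs: "Re (a g) = f g" "Re (a g * P) = f (g \<otimes> x)"
  "Re (a g * Q) - t * Re (b g) = f (g \<otimes> y)"
  "Re (a g * P * Q) - t * Re (b g * cnj P) = f (g \<otimes> (x \<otimes> y))"
  using half_traces_ab[of g] unfolding half_traces_def by blast+

text \<open>Cayley-Hamilton for \<open>X\<close>, the matrix counterpart of
  \<open>f_square_mid\<close>.\<close>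

lemma P_square: "P * P = 2 * of_real (f x) * P - 1"
  using s_square unfolding P_def by (simp add: complex_eq_iff algebra_simps)

lemma ab_one: "a \<one> = 1" "b \<one> = 0"
proof -
  have "half_traces 1 0 (f \<one>) (f (\<one> \<otimes> x)) (f (\<one> \<otimes> y)) (f (\<one> \<otimes> (x \<otimes> y)))"
    unfolding half_traces_def using s_e by (simp add: f_one P_def Q_def)
  then show "a \<one> = 1" "b \<one> = 0" by (rule half_tracesI)+
qed

text \<open>Right multiplication by \<open>X\<close>. The half traces to be matched involve
  \<open>X X\<close> and \<open>X X Y\<close>; \<open>P_square\<close> reduces them exactly as
  \<open>f_square_mid\<close> reduces the values of \<open>f\<close>.\<close>

lemma ab_mult_x:
  assumes [simp]: "g \<in> carrier G"
  shows "a (g \<otimes> x) = a g * P" "b (g \<otimes> x) = b g * cnj P"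
proof -
  have 1: "Re (v * P * P) = 2 * f x * Re (v * P) - Re v" for v
    unfolding mult.assoc P_square by (simp add: algebra_simps)
  have 2: "Re (v * cnj P * cnj P) = 2 * f x * Re (v * cnj P) - Re v" for v
    unfolding mult.assoc complex_cnj_mult[symmetric] P_square by (simp add: algebra_simps)
  have 3: "Re (v * P * P * Q) = 2 * f x * Re (v * P * Q) - Re (v * Q)" for v
    using 1[of "v * Q"] by (simp add: ac_simps)
  have "half_traces (a g * P) (b g * cnj P) (f (g \<otimes> x)) (f (g \<otimes> x \<otimes> x)) (f (g \<otimes> x \<otimes> y))
      (f (g \<otimes> x \<otimes> (x \<otimes> y)))"
  proof -
    have "Re (a g * P) = f (g \<otimes> x)"
      "2 * f x * Re (a g * P) - Re (a g) = f (g \<otimes> x \<otimes> x)"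
      using half_traces_eqs[of g] f_square_right[of g x] by (simp_all add: m_assoc)
    moreover have "Re (a g * P * Q) - t * Re (b g * cnj P) = f (g \<otimes> x \<otimes> y)"
      using half_traces_eqs[of g] by (simp add: m_assoc)
    moreover have "2 * f x * Re (a g * P * Q) - Re (a g * Q)
      - t * (2 * f x * Re (b g * cnj P) - Re (b g)) = f (g \<otimes> x \<otimes> (x \<otimes> y))"
    proof -
      have "f (g \<otimes> x \<otimes> (x \<otimes> y)) = 2 * f x * f (g \<otimes> (x \<otimes> y)) - f (g \<otimes> y)"
        using f_square_mid[of g x y] by (simp add: m_assoc)
      then show ?thesis using half_traces_eqs[of g] by algebra
    qed
    ultimately show ?thesis unfolding half_traces_def 1 2 3 by blast
  qed
  then show "a (g \<otimes> x) = a g * P" "b (g \<otimes> x) = b g * cnj P" by (rule half_tracesI)+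
qed

text \<open>Right multiplication by \<open>Y\<close>. The facts \<open>yx\<close>,
  \<open>yy\<close>, \<open>yxy\<close> express the new values of \<open>f\<close> through those at
  \<open>g\<close>, \<open>g x\<close>, \<open>g y\<close>, \<open>g x y\<close>, and the matrix
  entries satisfy the same relations.\<close>

lemma ab_mult_y:
  assumes g[simp]: "g \<in> carrier G"
  shows "a (g \<otimes> y) = a g * Q - b g * t" "b (g \<otimes> y) = a g * t + b g * cnj Q"
proof -
  define A B C D where "A = Re (a g)" "B = Im (a g)" "C = Re (b g)" "D = Im (b g)"
  have h1: "A = f g"
    using half_traces_eqs(1)[of g] by (simp add: A_B_C_D_def)
  have h2: "A * f x - B * s = f (g \<otimes> x)"
    using half_traces_eqs(2)[of g] by (simp add: A_B_C_D_def P_def)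
  have h3: "A * f y - B * e - t * C = f (g \<otimes> y)"
    using half_traces_eqs(3)[of g] by (simp add: A_B_C_D_def Q_def)
  have h4: "(A * f x - B * s) * f y - (A * s + B * f x) * e - t * (C * f x + D * s)
      = f (g \<otimes> (x \<otimes> y))"
    using half_traces_eqs(4)[of g] by (simp add: A_B_C_D_def P_def Q_def)
  note h = h1 h2 h3 h4
  \<comment> \<open>\<open>inv y \<otimes> inv x\<close> is reached from
    \<open>y \<otimes> x\<close> by inverting one letter at a time, and from
    \<open>x \<otimes> y\<close> by inverting the whole product.\<close>
  have yx: "f (g \<otimes> (y \<otimes> x)) = 2 * f y * f (g \<otimes> x) + 2 * f x * f (g \<otimes> y)
      + (2 * f (x \<otimes> y) - 4 * f x * f y) * f g - f (g \<otimes> (x \<otimes> y))"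
  proof -
    have 1: "f (g \<otimes> (y \<otimes> x)) + f (g \<otimes> (inv y \<otimes> x)) = 2 * f y * f (g \<otimes> x)"
      by (rule dalembert_mid) simp_all
    have 2: "f (g \<otimes> (inv y \<otimes> x)) + f (g \<otimes> (inv y \<otimes> inv x)) = 2 * f x * f (g \<otimes> inv y)"
      using dalembert_mid[of "g \<otimes> inv y" x \<one>] by (simp add: m_assoc)
    have 3: "f (g \<otimes> (x \<otimes> y)) + f (g \<otimes> (inv y \<otimes> inv x)) = 2 * f (x \<otimes> y) * f g"
      using dalembert_right[of g "x \<otimes> y"] by (simp add: inv_mult_group)
    have 4: "f (g \<otimes> inv y) = 2 * f g * f y - f (g \<otimes> y)"
      using dalembert_right[of g y] by simp
    show ?thesis using 1 2 3 unfolding 4 by (simp add: algebra_simps)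
  qed
  \<comment> \<open>Here \<open>y x y\<close> is read as \<open>inv x\<close> times the square of
    \<open>x y\<close>.\<close>
  have yxy: "f (g \<otimes> (y \<otimes> (x \<otimes> y))) = 2 * f (x \<otimes> y) * f (g \<otimes> y) - 2 * f x * f g + f (g \<otimes> x)"
    using f_square_right[of "g \<otimes> inv x" "x \<otimes> y"] dalembert_right[of g x]
    by (simp add: m_assoc inv_cancel algebra_simps)
  have yy: "f (g \<otimes> (y \<otimes> y)) = 2 * f y * f (g \<otimes> y) - f g"
    by (rule f_square_right) simp_all
  have r: "f (x \<otimes> y) = f x * f y - s * e" using s_e by simp
  have ss: "s * s = 1 - f x * f x" and tt: "t * t = 1 - f y * f y - e * e"
    by (rule s_square t_square)+
  have "half_traces (a g * Q - b g * t) (a g * t + b g * cnj Q) (f (g \<otimes> y)) (f (g \<otimes> y \<otimes> x))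
     (f (g \<otimes> y \<otimes> y)) (f (g \<otimes> y \<otimes> (x \<otimes> y)))"
    unfolding half_traces_def
  proof (intro conjI)
    show "Re (a g * Q - b g * t) = f (g \<otimes> y)"
      unfolding h[symmetric] A_B_C_D_def Q_def by (simp add: algebra_simps)
    have "Re ((a g * Q - b g * t) * P) =
      (A * f y - B * e - t * C) * f x - (A * e + B * f y - t * D) * s"
      unfolding A_B_C_D_def P_def Q_def by (simp add: algebra_simps)
    also have "\<dots> = f (g \<otimes> (y \<otimes> x))"
      unfolding yx r unfolding h[symmetric] by (simp add: algebra_simps)
    finally show "Re ((a g * Q - b g * t) * P) = f (g \<otimes> y \<otimes> x)" by (simp add: m_assoc)
    have "Re ((a g * Q - b g * t) * Q) - t * Re (a g * t + b g * cnj Q) =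
      (A * f y - B * e - t * C) * f y - (A * e + B * f y - t * D) * e
       - t * (A * t + C * f y + D * e)"
      unfolding A_B_C_D_def Q_def by (simp add: algebra_simps)
    also have "\<dots> = f (g \<otimes> (y \<otimes> y))"
      unfolding yy unfolding h[symmetric] using tt by algebra
    finally show "Re ((a g * Q - b g * t) * Q) - t * Re (a g * t + b g * cnj Q) = f (g \<otimes> y \<otimes> y)"
      by (simp add: m_assoc)
    have "Re ((a g * Q - b g * t) * P * Q) - t * Re ((a g * t + b g * cnj Q) * cnj P) =
      (A * f y - B * e - t * C) * (f x * f y - s * e)
      - (A * e + B * f y - t * D) * (f x * e + s * f y)
      - t * ((A * t + C * f y + D * e) * f x + (B * t + D * f y - C * e) * s)"
      unfolding A_B_C_D_def P_def Q_def by (simp add: algebra_simps)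
    also have "\<dots> = f (g \<otimes> (y \<otimes> (x \<otimes> y)))"
      unfolding yxy r unfolding h[symmetric] using ss tt by algebra
    finally show "Re ((a g * Q - b g * t) * P * Q) - t * Re ((a g * t + b g * cnj Q) * cnj P)
      = f (g \<otimes> y \<otimes> (x \<otimes> y))" by (simp add: m_assoc)
  qed
  then show "a (g \<otimes> y) = a g * Q - b g * t" "b (g \<otimes> y) = a g * t + b g * cnj Q"
    by (rule half_tracesI)+
qed

lemma half_traces_add:
  assumes "half_traces u v c1 cx cy cxy" "half_traces u' v' c1' cx' cy' cxy'"
  shows "half_traces (u + u') (v + v') (c1 + c1') (cx + cx') (cy + cy') (cxy + cxy')"
  using assms unfolding half_traces_def distrib_right plus_complex.sel distrib_left
  by (intro conjI; linarith)

lemma half_traces_scale: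
  assumes "half_traces u v c1 cx cy cxy"
  shows "half_traces (of_real r * u) (of_real r * v) (r * c1) (r * cx) (r * cy) (r * cxy)"
proof -
  have "Re (of_real r * z) = r * Re z" for z by simp
  then show ?thesis using assms unfolding half_traces_def mult.assoc
    by (simp only: right_diff_distrib mult.left_commute[of t])
       (simp only: right_diff_distrib[symmetric])
qed

text \<open>A quaternion depends linearly on its half traces, and for \<open>a\<close> and
  \<open>b\<close> these are translates of \<open>f\<close>.\<close>

lemma ab_linear:
  assumes [simp]: "z \<in> carrier G" "u \<in> carrier G" "w \<in> carrier G"
  shows "a (z \<otimes> (u \<otimes> w)) + a (z \<otimes> (inv u \<otimes> w)) = 2 * f u * a (z \<otimes> w)"
    "b (z \<otimes> (u \<otimes> w)) + b (z \<otimes> (inv u \<otimes> w)) = 2 * f u * b (z \<otimes> w)"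
proof -
  have 1: "f (z \<otimes> (u \<otimes> w) \<otimes> v) + f (z \<otimes> (inv u \<otimes> w) \<otimes> v) = 2 * f u * f (z \<otimes> w \<otimes> v)"
    if "v \<in> carrier G" for v
    using dalembert_mid[of z u "w \<otimes> v"] that by (simp add: m_assoc)
  note * = half_traces_add[OF half_traces_ab[of "z \<otimes> (u \<otimes> w)"] half_traces_ab[of "z \<otimes> (inv u \<otimes> w)"]]
  note ** = half_traces_scale[OF half_traces_ab[of "z \<otimes> w"], of "2 * f u"]
  have "half_traces (a (z \<otimes> (u \<otimes> w)) + a (z \<otimes> (inv u \<otimes> w)))
     (b (z \<otimes> (u \<otimes> w)) + b (z \<otimes> (inv u \<otimes> w))) (2 * f u * f (z \<otimes> w)) (2 * f u * f (z \<otimes> w \<otimes> x))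
     (2 * f u * f (z \<otimes> w \<otimes> y)) (2 * f u * f (z \<otimes> w \<otimes> (x \<otimes> y)))"
    using * 1[of x] 1[of y] 1[of "x \<otimes> y"] dalembert_mid[of z u w] by simp
  from half_traces_unique[OF this **]
  show "a (z \<otimes> (u \<otimes> w)) + a (z \<otimes> (inv u \<otimes> w)) = 2 * f u * a (z \<otimes> w)"
    "b (z \<otimes> (u \<otimes> w)) + b (z \<otimes> (inv u \<otimes> w)) = 2 * f u * b (z \<otimes> w)"
    by simp_all
qed

lemma f_mult_eq:
  assumes g[simp]: "g \<in> carrier G" and z: "z \<in> carrier G"
  shows "f (g \<otimes> z) = Re (a g * a z - b g * cnj (b z))"
proof -
  define K where "K z = f (g \<otimes> z) - Re (a g * a z - b g * cnj (b z))" for z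
  have "dalembert_linear K"
    unfolding dalembert_linear_def
  proof (intro ballI)
    fix z u w assume [simp]: "z \<in> carrier G" "u \<in> carrier G" "w \<in> carrier G"
    have 1: "f (g \<otimes> (z \<otimes> (u \<otimes> w))) + f (g \<otimes> (z \<otimes> (inv u \<otimes> w)))
        = 2 * f u * f (g \<otimes> (z \<otimes> w))"
      using dalembert_mid[of "g \<otimes> z" u w] by (simp add: m_assoc)
    have "K (z \<otimes> (u \<otimes> w)) + K (z \<otimes> (inv u \<otimes> w)) =
       (f (g \<otimes> (z \<otimes> (u \<otimes> w))) + f (g \<otimes> (z \<otimes> (inv u \<otimes> w))))
       - Re (a g * (a (z \<otimes> (u \<otimes> w)) + a (z \<otimes> (inv u \<otimes> w)))
         - b g * cnj (b (z \<otimes> (u \<otimes> w)) + b (z \<otimes> (inv u \<otimes> w))))"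
      unfolding K_def by (simp add: algebra_simps)
    also have "\<dots> = 2 * f u * K (z \<otimes> w)"
      unfolding 1 ab_linear[OF \<open>z \<in> _\<close> \<open>u \<in> _\<close> \<open>w \<in> _\<close>] unfolding K_def
      by (simp add: algebra_simps)
    finally show "K (z \<otimes> (u \<otimes> w)) + K (z \<otimes> (inv u \<otimes> w)) = 2 * f u * K (z \<otimes> w)" .
  qed
  \<comment> \<open>The images of the four points are 1, \<open>X\<close>, \<open>Y\<close>,
    \<open>X Y\<close>, so vanishing there is the defining property of \<open>a g\<close> and
    \<open>b g\<close>.\<close>
  moreover have "K \<one> = 0" unfolding K_def by (simp add: ab_one half_traces_eqs(1))
  moreover have "K x = 0"
    unfolding K_def using ab_mult_x[of \<one>] half_traces_eqs(2)[of g] by (simp add: ab_one)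
  moreover have "K y = 0"
    unfolding K_def using ab_mult_y[of \<one>] half_traces_eqs(3)[of g] by (simp add: ab_one mult.commute)
  moreover have "K (x \<otimes> y) = 0"
    unfolding K_def using ab_mult_x[of \<one>] ab_mult_y[of x] half_traces_eqs(4)[of g]
    by (simp add: ab_one algebra_simps)
  ultimately have "K z = 0"
    using dalembert_linear_eq_0[of K x y z] commutator z by simp
  then show ?thesis unfolding K_def by simp
qed

text \<open>Applying \<open>f_mult_eq\<close> to \<open>g\<close> and each of \<open>h\<close>,
  \<open>h x\<close>, \<open>h y\<close>, \<open>h x y\<close> gives the half traces of the product
  of the two quaternions.\<close>

lemma ab_mult:
  assumes g[simp]: "g \<in> carrier G" and h[simp]: "h \<in> carrier G"
  shows "a (g \<otimes> h) = a g * a h - b g * cnj (b h)" "b (g \<otimes> h) = a g * b h + b g * cnj (a h)"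
proof -
  have "half_traces (a g * a h - b g * cnj (b h)) (a g * b h + b g * cnj (a h)) (f (g \<otimes> h))
     (f (g \<otimes> h \<otimes> x)) (f (g \<otimes> h \<otimes> y)) (f (g \<otimes> h \<otimes> (x \<otimes> y)))"
  proof -
    have xy: "h \<otimes> (x \<otimes> y) = h \<otimes> x \<otimes> y" by (simp add: m_assoc)
    have eqs: "f (g \<otimes> h) = Re (a g * a h - b g * cnj (b h))"
      "f (g \<otimes> h \<otimes> x) = Re (a g * a (h \<otimes> x) - b g * cnj (b (h \<otimes> x)))"
      "f (g \<otimes> h \<otimes> y) = Re (a g * a (h \<otimes> y) - b g * cnj (b (h \<otimes> y)))"
      "f (g \<otimes> h \<otimes> (x \<otimes> y)) = Re (a g * a (h \<otimes> x \<otimes> y) - b g * cnj (b (h \<otimes> x \<otimes> y)))"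
      using f_mult_eq[of g h] f_mult_eq[of g "h \<otimes> x"] f_mult_eq[of g "h \<otimes> y"]
        f_mult_eq[of g "h \<otimes> x \<otimes> y"] by (simp_all add: m_assoc)
    show ?thesis
      unfolding half_traces_def eqs ab_mult_y[OF h] ab_mult_y[OF m_closed[OF h x]] ab_mult_x[OF h]
      by (simp add: algebra_simps)
  qed
  then show "a (g \<otimes> h) = a g * a h - b g * cnj (b h)" "b (g \<otimes> h) = a g * b h + b g * cnj (a h)"
    by (rule half_tracesI)+
qed

text \<open>Linearity shows that \<open>inv g\<close> goes to the conjugate quaternion;
  multiplicativity then gives norm 1.\<close>

lemma ab_norm:
  assumes g[simp]: "g \<in> carrier G"
  shows "a g * cnj (a g) + b g * cnj (b g) = 1"
proof -
  have "a g + a (inv g) = 2 * of_real (f g)" "b g + b (inv g) = 0"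
    using ab_linear[of \<one> g \<one>] by (simp_all add: ab_one)
  moreover have "a g + cnj (a g) = 2 * of_real (f g)"
    unfolding complex_add_cnj by (simp add: a_def)
  ultimately have "a (inv g) = cnj (a g)" "b (inv g) = - b g"
    by (metis add_left_cancel, metis add_eq_0_iff)
  then show ?thesis using ab_mult(1)[of g "inv g"] by (simp add: ab_one)
qed

end

section \<open>From the long equation to the short one\<close>

lemma long_dalembert_imp_dalembert:
  fixes G (structure) and f :: "'a \<Rightarrow> real"
  assumes "group G"
    and one: "f \<one> = 1"
    and bound: "\<And>x. x \<in> carrier G \<Longrightarrow> \<bar>f x\<bar> \<le> 1"
    and long: "\<And>x y. x \<in> carrier G \<Longrightarrow> y \<in> carrier G \<Longrightarrow>
      f (x \<otimes> y) + f (y \<otimes> x) + f (x \<otimes> inv y) + f (inv y \<otimes> x) = 4 * f x * f y"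
  shows "dalembert_function G f"
proof -
  interpret group G by fact
  have "f (x \<otimes> z) + f (inv x \<otimes> z) = 2 * f x * f z"
    if x[simp]: "x \<in> carrier G" and z[simp]: "z \<in> carrier G" for x z
  proof -
    define c where "c = f x"
    \<comment> \<open>\<open>L z\<close> is \<open>f (A z)\<close> and \<open>R z\<close> is
      \<open>f (z A)\<close> for \<open>A = x + inv x - 2 c\<close> in the group algebra.\<close>
    define L where "L z = f (x \<otimes> z) + f (inv x \<otimes> z) - 2 * c * f z" for z
    define R where "R z = f (z \<otimes> x) + f (z \<otimes> inv x) - 2 * c * f z" for z
    have LR: "L z + R z = 0" if "z \<in> carrier G" for z
      using long[of z x] that unfolding L_def R_def c_def by (simp add: algebra_simps)
    have f2: "f (x \<otimes> x) = 2 * c * c - 1"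
      using long[of x x] one unfolding c_def by simp
    have LL: "L (x \<otimes> z) + L (inv x \<otimes> z) - 2 * c * L z = 0" if z[simp]: "z \<in> carrier G" for z
    proof -
      have 1: "L z = - R z" if "z \<in> carrier G" for z using LR[OF that] by simp
      \<comment> \<open>Changing sign at each crossing:
        \<open>f (A A z) = - f (A z A) = f (z A A)\<close>.\<close>
      have "L (x \<otimes> z) + L (inv x \<otimes> z) - 2 * c * L z = R (z \<otimes> x) + R (z \<otimes> inv x) - 2 * c * R z"
      proof -
        have "L (x \<otimes> z) + L (inv x \<otimes> z) - 2 * c * L z
          = - (R (x \<otimes> z) + R (inv x \<otimes> z) - 2 * c * R z)"
          by (simp add: 1)
        also have "\<dots> = - (L (z \<otimes> x) + L (z \<otimes> inv x) - 2 * c * L z)"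
          unfolding L_def R_def by (simp add: m_assoc algebra_simps)
        also have "\<dots> = R (z \<otimes> x) + R (z \<otimes> inv x) - 2 * c * R z"
          by (simp add: 1)
        finally show ?thesis .
      qed
      \<comment> \<open>The long equation for \<open>x \<otimes> x\<close> and for \<open>x\<close>
        evaluates the sum \<open>f (A A z) + f (z A A)\<close>.\<close>
      moreover have "L (x \<otimes> z) + L (inv x \<otimes> z) - 2 * c * L z
          + (R (z \<otimes> x) + R (z \<otimes> inv x) - 2 * c * R z) = 0"
      proof -
        have 2: "f (z \<otimes> (x \<otimes> x)) + f (x \<otimes> (x \<otimes> z)) + f (z \<otimes> (inv x \<otimes> inv x))
            + f (inv x \<otimes> (inv x \<otimes> z)) = 4 * f z * (2 * c * c - 1)"
          using long[of z "x \<otimes> x"] unfolding f2 by (simp add: m_assoc inv_mult_group)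
        have 3: "f (z \<otimes> x) + f (x \<otimes> z) + f (z \<otimes> inv x) + f (inv x \<otimes> z) = 4 * f z * c"
          using long[of z x] unfolding c_def by simp
        have "L (x \<otimes> z) + L (inv x \<otimes> z) - 2 * c * L z
          + (R (z \<otimes> x) + R (z \<otimes> inv x) - 2 * c * R z) =
          (f (z \<otimes> (x \<otimes> x)) + f (x \<otimes> (x \<otimes> z)) + f (z \<otimes> (inv x \<otimes> inv x))
            + f (inv x \<otimes> (inv x \<otimes> z))) + 4 * f z
          - 4 * c * (f (z \<otimes> x) + f (x \<otimes> z) + f (z \<otimes> inv x) + f (inv x \<otimes> z)) + 8 * c * c * f z"
          unfolding L_def R_def by (simp add: m_assoc inv_cancel algebra_simps)
        also have "\<dots> = 0" unfolding 2 3 by (simp add: algebra_simps)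
        finally show ?thesis .
      qed
      ultimately show ?thesis by simp
    qed
    \<comment> \<open>The shift by \<open>inv x\<close> makes the first term of the sequence
      \<open>u\<close> equal to \<open>L z\<close>.\<close>
    define w where "w = inv x \<otimes> z"
    have w[simp]: "w \<in> carrier G" unfolding w_def by simp
    have pow: "x [^] Suc n \<otimes> w = x \<otimes> (x [^] n \<otimes> w)" for n
      using nat_pow_Suc2[OF x, of n] by (simp add: m_assoc)
    have pow_closed: "x [^] (n::nat) \<otimes> w \<in> carrier G" for n by simp
    have pow_inv: "inv x \<otimes> (x [^] Suc n \<otimes> w) = x [^] n \<otimes> w" for n
      unfolding pow using inv_cancel(1)[OF x pow_closed] .
    have "L (x [^] Suc 0 \<otimes> w) = 0"
    proof (rule bounded_double_root_recurrence)
      show "\<bar>c\<bar> \<le> 1" unfolding c_def by (rule bound) simp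
      show "\<bar>f (x [^] n \<otimes> w)\<bar> \<le> 1" for n :: nat by (rule bound) simp
      show "L (x [^] Suc n \<otimes> w) = f (x [^] (n + 2) \<otimes> w) + f (x [^] n \<otimes> w)
          - 2 * c * f (x [^] (n + 1) \<otimes> w)" for n
        unfolding L_def pow_inv unfolding pow[symmetric] by simp
      show "L (x [^] Suc (n + 2) \<otimes> w) + L (x [^] Suc n \<otimes> w) = 2 * c * L (x [^] Suc (n + 1) \<otimes> w)" for n
        using LL[OF pow_closed, of "Suc (n + 1)"]
        unfolding pow_inv pow[symmetric] by simp
    qed
    then show ?thesis by (simp add: w_def L_def c_def inv_cancel)
  qed
  then show ?thesis
    by (unfold_locales) (use one bound in auto)
qed

section \<open>Continuous representations into SU(2)\<close>

text \<open>The common ending of all cases: \<open>(a g, b g)\<close> is the first row of a matrix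
  in SU(2), and the product rules are those of such rows. The abelian cases take
  \<open>b = 0\<close>, the diagonal torus.\<close>

lemma SU2_representation_quaternionI:
  fixes G (structure) and a b :: "'a \<Rightarrow> complex"
  assumes a: "continuous_map T euclidean a" and b: "continuous_map T euclidean b"
    and top: "topspace T = carrier G"
    and norm: "\<And>g. g \<in> carrier G \<Longrightarrow> a g * cnj (a g) + b g * cnj (b g) = 1"
    and mult: "\<And>g h. g \<in> carrier G \<Longrightarrow> h \<in> carrier G \<Longrightarrow> a (g \<otimes> h) = a g * a h - b g * cnj (b h)"
      "\<And>g h. g \<in> carrier G \<Longrightarrow> h \<in> carrier G \<Longrightarrow> b (g \<otimes> h) = a g * b h + b g * cnj (a h)"
  shows "\<exists>\<phi>. SU2_representation G T \<phi> \<and> (\<forall>g. rep_character \<phi> g = 2 * Re (a g))"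
proof -
  define M :: "complex \<times> complex \<Rightarrow> complex^2^2" where
    "M p = (\<chi> i j. if i = 1 then (if j = 1 then fst p else snd p)
       else (if j = 1 then - cnj (snd p) else cnj (fst p)))" for p
  define \<phi> where "\<phi> g = M (a g, b g)" for g
  have su: "\<phi> g \<in> carrier SU2" if "g \<in> carrier G" for g
    using norm[OF that]
    unfolding \<phi>_def M_def SU2_def unitary_matrix_def conj_transpose_def matrix_matrix_mult_def mat_def
    by (auto simp: vec_eq_iff forall_2 sum_2 det_2 algebra_simps)
  have "\<phi> (g \<otimes> h) = \<phi> g ** \<phi> h" if "g \<in> carrier G" "h \<in> carrier G" for g h
    unfolding \<phi>_def M_def matrix_matrix_mult_def mult[OF that]
    by (auto simp: vec_eq_iff forall_2 sum_2 algebra_simps)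
  then have hom: "\<phi> \<in> hom G SU2"
    using su unfolding hom_def by (auto simp: SU2_def)
  have M: "continuous_on UNIV M"
    unfolding M_def
  proof (intro continuous_on_vec_lambda)
    fix i j :: 2
    show "continuous_on UNIV (\<lambda>p. if i = 1 then (if j = 1 then fst p else snd p)
       else (if j = 1 then - cnj (snd p) else cnj (fst p)))"
      by (cases "i = 1"; cases "j = 1") (auto intro!: continuous_intros)
  qed
  have "continuous_map T (prod_topology euclidean euclidean) (\<lambda>g. (a g, b g))"
    by (intro continuous_map_pairedI a b)
  then have "continuous_map T euclidean (\<lambda>g. (a g, b g))"
    by (simp add: euclidean_product_topology)
  then have "continuous_map T euclidean (M \<circ> (\<lambda>g. (a g, b g)))"
    using M by (intro continuous_map_compose) auto
  then have "continuous_map T euclidean \<phi>" unfolding \<phi>_def comp_def .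
  then have "continuous_map T (top_of_set (carrier SU2)) \<phi>"
    using su top by (auto simp: continuous_map_in_subtopology)
  with hom have "SU2_representation G T \<phi>" unfolding SU2_representation_def ..
  moreover have "rep_character \<phi> g = 2 * Re (a g)" for g
    unfolding rep_character_def \<phi>_def M_def trace_def
    by (simp add: sum_2 complex_add_cnj)
  ultimately show ?thesis by blast
qed

lemma continuous_map_Complex:
  assumes "continuous_map T euclideanreal u" "continuous_map T euclideanreal v"
  shows "continuous_map T euclidean (\<lambda>g. Complex (u g) (v g))"
proof -
  have "continuous_map T (prod_topology euclidean euclidean) (\<lambda>g. (u g, v g))"
    by (intro continuous_map_pairedI assms)
  then have "continuous_map T euclidean (\<lambda>g. (u g, v g))"
    by (simp add: euclidean_product_topology)
  moreover have "continuous_on UNIV (\<lambda>p. Complex (fst p) (snd p))"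
    by (intro continuous_intros)
  ultimately have "continuous_map T euclidean ((\<lambda>p. Complex (fst p) (snd p)) \<circ> (\<lambda>g. (u g, v g)))"
    by (intro continuous_map_compose) auto
  then show ?thesis unfolding comp_def by simp
qed

lemma (in topological_group) continuous_map_right_translation:
  assumes "x \<in> carrier G" "continuous_map T U f"
  shows "continuous_map T U (\<lambda>g. f (g \<otimes> x))"
proof -
  have "continuous_map T (prod_topology T T) (\<lambda>g. (g, x))"
    using assms(1) topspace_eq_carrier by (simp add: continuous_map_pairedI)
  from continuous_map_compose[OF this continuous_mult]
  have "continuous_map T T (\<lambda>g. g \<otimes> x)" by (simp add: comp_def)
  from continuous_map_compose[OF this assms(2)] show ?thesis by (simp add: comp_def)
qed

lemma dalembert_function_SU2:
  fixes G (structure) and f :: "'a \<Rightarrow> real"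
  assumes "topological_group G T" and "dalembert_function G f"
    and f: "continuous_map T euclideanreal f"
  shows "\<exists>\<phi>. SU2_representation G T \<phi> \<and> (\<forall>g\<in>carrier G. rep_character \<phi> g = 2 * f g)"
proof -
  interpret topological_group G T by fact
  interpret dalembert_function G f by fact
  note cont = f continuous_map_right_translation[OF _ f]
  \<comment> \<open>Values at commutators are at most 1. If all are 1, \<open>f\<close> is the real
    part of a circle-valued character, or, when it takes only the values 1 and -1, itself a
    homomorphism.\<close>
  consider (frame) x y where "x \<in> carrier G" "y \<in> carrier G"
      "f (inv x \<otimes> (inv y \<otimes> (x \<otimes> y))) < 1"
    | (torus) x where "x \<in> carrier G" "(f x)\<^sup>2 \<noteq> 1"
      "\<And>x y. x \<in> carrier G \<Longrightarrow> y \<in> carrier G \<Longrightarrow> f (inv x \<otimes> (inv y \<otimes> (x \<otimes> y))) = 1"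
    | (sign) "\<And>x. x \<in> carrier G \<Longrightarrow> (f x)\<^sup>2 = 1"
    using f_commutator_le by (meson order_less_le)
  then show ?thesis
  proof cases
    case frame
    then interpret dalembert_frame G f x y
      by unfold_locales
    have m: "continuous_map T euclideanreal m1"
      unfolding m1_def divide_inverse by (intro continuous_intros cont frame)
    have m2: "continuous_map T euclideanreal m2"
      unfolding m2_def divide_inverse by (intro continuous_intros cont m frame)
    have m3: "continuous_map T euclideanreal m3"
      unfolding m3_def divide_inverse by (intro continuous_intros cont m m2 frame m_closed)
    have "continuous_map T euclidean a" "continuous_map T euclidean b"
      unfolding a_def b_def by (intro continuous_map_Complex f m m2 m3)+
    then have "\<exists>\<phi>. SU2_representation G T \<phi> \<and> (\<forall>g. rep_character \<phi> g = 2 * Re (a g))"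
      by (rule SU2_representation_quaternionI) (simp_all add: topspace_eq_carrier ab_norm ab_mult)
    then show ?thesis by (simp only: half_traces_eqs(1)) blast
  next
    case torus
    define a where "a g = Complex (f g) (sine x g)" for g
    have ch: "f (g \<otimes> h) = f g * f h - sine x g * sine x h"
      "sine x (g \<otimes> h) = f g * sine x h + sine x g * f h"
      if "g \<in> carrier G" "h \<in> carrier G" for g h
      using abelian_character[of x g h] torus that by blast+
    have "continuous_map T euclideanreal (sine x)"
      unfolding sine_def divide_inverse by (intro continuous_intros cont torus)
    then have a: "continuous_map T euclidean a"
      unfolding a_def by (intro continuous_map_Complex f)
    have mult: "a (g \<otimes> h) = a g * a h" if "g \<in> carrier G" "h \<in> carrier G" for g h
      unfolding a_def using ch[OF that] by (simp add: complex_eq_iff)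
    have one: "a \<one> = 1" unfolding a_def sine_def using torus(1) by (simp add: f_one complex_eq_iff)
    have "a g * cnj (a g) = 1" if g[simp]: "g \<in> carrier G" for g
    proof -
      have "f x * f g - f (inv g \<otimes> x) = - (f x * f g - f (g \<otimes> x))"
        using dalembert[of g x] torus(1) by simp
      then have "sine x (inv g) = - sine x g"
        unfolding sine_def f_inv[OF g] by (simp only: minus_divide_left)
      then have "a (inv g) = cnj (a g)"
        unfolding a_def by (simp add: f_inv complex_eq_iff)
      then show ?thesis using mult[of g "inv g"] one by simp
    qed
    then show ?thesis
      using SU2_representation_quaternionI[OF a _ topspace_eq_carrier, of "\<lambda>_. 0"] mult
      by (auto simp: a_def)
  next
    case sign
    define a where "a g = complex_of_real (f g)" for g
    have a: "continuous_map T euclidean a"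
      unfolding a_def complex_of_real_def by (intro continuous_map_Complex f) auto
    have "a (g \<otimes> h) = a g * a h" if "g \<in> carrier G" "h \<in> carrier G" for g h
      unfolding a_def using f_mult_square_one[OF that sign] that by simp
    moreover have "a g * cnj (a g) = 1" if "g \<in> carrier G" for g
      unfolding a_def using sign[OF that]
      by (simp add: power2_eq_square flip: of_real_mult)
    ultimately show ?thesis
      using SU2_representation_quaternionI[OF a _ topspace_eq_carrier, of "\<lambda>_. 0"]
      by (auto simp: a_def)
  qed
qed

section \<open>Reduction to a real function bounded by 1\<close>

theorem theorem3p4:
  fixes G :: "('a, 'm) monoid_scheme" (structure)
    and T :: "'a topology"
    and f :: "'a \<Rightarrow> complex"
  assumes "compact_group G T"
    and "continuous_map T euclidean f"
    and "\<exists>x\<in>carrier G. f x \<noteq> 0"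
    and "\<forall>x\<in>carrier G. \<forall>y\<in>carrier G.
      f (x \<otimes> y) + f (y \<otimes> x) + f (x \<otimes> inv y) + f (inv y \<otimes> x) = 4 * f x * f y"
  shows "\<exists>\<phi>. SU2_representation G T \<phi> \<and> (\<forall>x\<in>carrier G. f x = rep_character \<phi> x / 2)"
proof -
  interpret compact_group G T by fact
  note long = assms(4)[rule_format]
  obtain x0 where x0: "x0 \<in> carrier G" "f x0 \<noteq> 0" using assms(3) by blast
  have one: "f \<one> = 1" using long[of x0 \<one>] x0 by simp
  \<comment> \<open>Compactness supplies the bound for the recurrence along powers of
    \<open>x\<close>.\<close>
  have "compact (f ` carrier G)"
    using image_compactin[OF _ assms(2), of "carrier G"] compact topspace_eq_carrier
    by (simp add: compact_space_def)
  then have "bounded (f ` carrier G)" by (rule compact_imp_bounded)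
  then obtain B where B: "cmod (f x) \<le> B" if "x \<in> carrier G" for x
    unfolding bounded_iff by fast
  have unit: "f x \<in> \<real>" "cmod (f x) \<le> 1" if x[simp]: "x \<in> carrier G" for x
  proof -
    define h where "h n = f (x [^] n)" for n :: nat
    have rec: "h (n + 2) + h n = 2 * h 1 * h (n + 1)" for n
    proof -
      have 1: "x \<otimes> x [^] Suc n = x [^] Suc (Suc n)" for n
        using nat_pow_Suc2[OF x, of "Suc n"] by simp
      have 2: "inv x \<otimes> x [^] Suc n = x [^] n"
        unfolding nat_pow_Suc2[OF x] by (simp add: m_assoc[symmetric])
      have 3: "x [^] Suc n \<otimes> inv x = x [^] n" by (simp add: m_assoc)
      \<comment> \<open>Powers of \<open>x\<close> commute, so the four terms of the long equation
        coincide in pairs.\<close>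
      have "2 * (h (n + 2) + h n) = 2 * (2 * h 1 * h (n + 1))"
        using long[of "x [^] Suc n" x] unfolding 1 2 3 h_def
        by (simp add: algebra_simps del: nat_pow_Suc)
      then show ?thesis by (simp only: mult_cancel_left) simp
    qed
    have hB: "cmod (h n) \<le> B" for n unfolding h_def by (rule B) simp
    have h0: "h 0 = 1" unfolding h_def using one by simp
    have h1: "h 1 = f x" unfolding h_def by simp
    show "f x \<in> \<real>" "cmod (f x) \<le> 1"
      using bounded_chebyshev_recurrence[OF h0 rec hB] unfolding h1 by simp_all
  qed
  define r where "r x = Re (f x)" for x
  have fr: "f x = of_real (r x)" if "x \<in> carrier G" for x
    using unit(1)[OF that] unfolding r_def by (simp add: of_real_Re)
  have "dalembert_function G r"
  proof (rule long_dalembert_imp_dalembert)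
    show "group G" ..
    show "r \<one> = 1" unfolding r_def using one by simp
    show "\<bar>r x\<bar> \<le> 1" if "x \<in> carrier G" for x
      using unit(2)[OF that] abs_Re_le_cmod[of "f x"] unfolding r_def by linarith
    fix x y assume [simp]: "x \<in> carrier G" "y \<in> carrier G"
    have "complex_of_real (r (x \<otimes> y) + r (y \<otimes> x) + r (x \<otimes> inv y) + r (inv y \<otimes> x))
      = of_real (4 * r x * r y)"
      using long[of x y] by (simp add: fr)
    then show "r (x \<otimes> y) + r (y \<otimes> x) + r (x \<otimes> inv y) + r (inv y \<otimes> x) = 4 * r x * r y"
      by (simp only: of_real_eq_iff)
  qed
  moreover have "continuous_map T euclideanreal r"
  proof -
    have "continuous_map T euclidean (Re \<circ> f)"
      by (rule continuous_map_compose[OF assms(2)]) (auto intro!: continuous_intros)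
    then show ?thesis unfolding r_def comp_def .
  qed
  ultimately obtain \<phi> where "SU2_representation G T \<phi>"
      "\<forall>g\<in>carrier G. rep_character \<phi> g = 2 * r g"
    using dalembert_function_SU2 topological_group_axioms by blast
  then show ?thesis using fr by auto
qed

end
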